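(* Let $q\ge 2$ and $d\ge1$ be integers. On the infinite $(q+1)$-regular tree $\mathbb{T}_{q+1}$, let $X,Y$ be vertices with $\operatorname{dist}(X,Y)=d$ and let $\beta_X^n,\beta_Y^n$ be the uniform probability measures on the balls of radius $n$ centered at $X$ and $Y$. Put $\delta=\lfloor d/2\rfloor$, $\delta'=\lceil d/2\rceil$. Then, as $n\to\infty$, \[ W_1(\beta_X^n, \beta_Y^n) = A^{\mathrm{ball}}_{d, q} \cdot n + B^{\mathrm{ball}}_{d,q} + o(1), \] where \[ A^{\mathrm{ball}}_{d,q} = \frac{2(q+1-q^{1-\delta'}-q^{-\delta})}{q+1},\qquad B^{\mathrm{ball}}_{d,q} = d + \frac{-6q-2+2(\delta'(q-1)+2)q^{1-\delta'} + 2(\delta(q-1)+q+1)q^{-\delta}}{q^2-1}. \]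
   Context: The ball of radius $r$ centered at $u$ is $\{v:\operatorname{dist}(u,v)\le r\}$ (it has $\frac{q^{r+1}+q^r-2}{q-1}$ vertices); $\beta_u^r$ assigns equal mass to each of its vertices and $0$ elsewhere. $W_1$ is the $1$-Wasserstein distance with respect to graph distance: the minimum over couplings $\pi$ of $\mu,\nu$ of $\sum_{v,w}\operatorname{dist}(v,w)\pi(v,w)$. *)

theory Defs
  imports "HOL-Probability.Probability" "HOL-Library.Landau_Symbols"
begin

definition simple_graph :: "'v set \<Rightarrow> ('v \<Rightarrow> 'v \<Rightarrow> bool) \<Rightarrow> bool" where
  "simple_graph V E \<longleftrightarrow>
     (\<forall>u v. E u v \<longrightarrow> u \<in> V \<and> v \<in> V \<and> u \<noteq> v \<and> E v u)"

definition walk :: "'v set \<Rightarrow> ('v \<Rightarrow> 'v \<Rightarrow> bool) \<Rightarrow> 'v \<Rightarrow> 'v list \<Rightarrow> 'v \<Rightarrow> bool" where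
  "walk V E u xs v \<longleftrightarrow>
     xs \<noteq> [] \<and> set xs \<subseteq> V \<and> successively E xs \<and> hd xs = u \<and> last xs = v"

definition connected_graph :: "'v set \<Rightarrow> ('v \<Rightarrow> 'v \<Rightarrow> bool) \<Rightarrow> bool" where
  "connected_graph V E \<longleftrightarrow> V \<noteq> {} \<and> (\<forall>u\<in>V. \<forall>v\<in>V. \<exists>xs. walk V E u xs v)"

text \<open>A cycle is given by its vertices, each listed once; the closing edge is implicit.\<close>

definition graph_cycle :: "'v set \<Rightarrow> ('v \<Rightarrow> 'v \<Rightarrow> bool) \<Rightarrow> 'v list \<Rightarrow> bool" where
  "graph_cycle V E xs \<longleftrightarrow>
     length xs \<ge> 3 \<and> distinct xs \<and> set xs \<subseteq> V \<and> successively E xs \<and> E (last xs) (hd xs)"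

definition tree :: "'v set \<Rightarrow> ('v \<Rightarrow> 'v \<Rightarrow> bool) \<Rightarrow> bool" where
  "tree V E \<longleftrightarrow> simple_graph V E \<and> connected_graph V E \<and> (\<nexists>xs. graph_cycle V E xs)"

definition regular :: "'v set \<Rightarrow> ('v \<Rightarrow> 'v \<Rightarrow> bool) \<Rightarrow> nat \<Rightarrow> bool" where
  "regular V E k \<longleftrightarrow> (\<forall>u\<in>V. finite {v \<in> V. E u v} \<and> card {v \<in> V. E u v} = k)"

definition gdist :: "'v set \<Rightarrow> ('v \<Rightarrow> 'v \<Rightarrow> bool) \<Rightarrow> 'v \<Rightarrow> 'v \<Rightarrow> nat" where
  "gdist V E u v = (LEAST k. \<exists>xs. walk V E u xs v \<and> length xs = k + 1)"

definition gball :: "'v set \<Rightarrow> ('v \<Rightarrow> 'v \<Rightarrow> bool) \<Rightarrow> 'v \<Rightarrow> nat \<Rightarrow> 'v set" where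
  "gball V E u r = {v \<in> V. gdist V E u v \<le> r}"

text \<open>\<open>pmf_of_set\<close> is meaningful on finite nonempty sets only; balls around vertices of a connected
  regular graph are such sets.\<close>

definition ball_measure :: "'v set \<Rightarrow> ('v \<Rightarrow> 'v \<Rightarrow> bool) \<Rightarrow> 'v \<Rightarrow> nat \<Rightarrow> 'v pmf" where
  "ball_measure V E u r = pmf_of_set (gball V E u r)"

definition couplings :: "'v pmf \<Rightarrow> 'v pmf \<Rightarrow> ('v \<times> 'v) pmf set" where
  "couplings \<mu> \<nu> = {\<pi>. map_pmf fst \<pi> = \<mu> \<and> map_pmf snd \<pi> = \<nu>}"

text \<open>The Bochner integral of a non-integrable cost is \<open>0\<close>, so such couplings (of infinite cost)
  have to be excluded explicitly. For finitely supported measures there are none, and the infimum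
  is a minimum: see \<open>W1_attained\<close> below.\<close>

definition W1 :: "'v set \<Rightarrow> ('v \<Rightarrow> 'v \<Rightarrow> bool) \<Rightarrow> 'v pmf \<Rightarrow> 'v pmf \<Rightarrow> real" where
  "W1 V E \<mu> \<nu> = Inf {measure_pmf.expectation \<pi> (\<lambda>(v, w). real (gdist V E v w)) |\<pi>.
     \<pi> \<in> couplings \<mu> \<nu> \<and> integrable (measure_pmf \<pi>) (\<lambda>(v, w). real (gdist V E v w))}"

definition A_ball :: "nat \<Rightarrow> nat \<Rightarrow> real" where
  "A_ball d q = (let \<delta> = \<lfloor>real d / 2\<rfloor>; \<delta>' = \<lceil>real d / 2\<rceil> in
     2 * (real q + 1 - real q powi (1 - \<delta>') - real q powi (- \<delta>)) / (real q + 1))"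

definition B_ball :: "nat \<Rightarrow> nat \<Rightarrow> real" where
  "B_ball d q = (let \<delta> = \<lfloor>real d / 2\<rfloor>; \<delta>' = \<lceil>real d / 2\<rceil> in
     real d + (- 6 * real q - 2
       + 2 * (real_of_int \<delta>' * (real q - 1) + 2) * real q powi (1 - \<delta>')
       + 2 * (real_of_int \<delta> * (real q - 1) + real q + 1) * real q powi (- \<delta>))
     / ((real q)\<^sup>2 - 1))"

lemma set_pmf_coupling:
  assumes "\<pi> \<in> couplings \<mu> \<nu>"
  shows "set_pmf \<pi> \<subseteq> set_pmf \<mu> \<times> set_pmf \<nu>"
  using assms by (force simp: couplings_def)

lemma coupling_marginals:
  assumes "\<pi> \<in> couplings \<mu> \<nu>" "finite (set_pmf \<mu>)" "finite (set_pmf \<nu>)"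
  shows "(\<Sum>w\<in>set_pmf \<nu>. pmf \<pi> (v, w)) = pmf \<mu> v"
    and "(\<Sum>v\<in>set_pmf \<mu>. pmf \<pi> (v, w)) = pmf \<nu> w"
proof -
  note sub = set_pmf_coupling[OF assms(1)]
  have "pmf \<mu> v = measure (measure_pmf \<pi>) (fst -` {v})"
    using assms(1) by (auto simp: couplings_def pmf_map)
  also have "\<dots> = measure (measure_pmf \<pi>) (Pair v ` set_pmf \<nu>)"
    using sub by (intro measure_prob_cong_0) (auto simp: set_pmf_iff)
  also have "\<dots> = (\<Sum>w\<in>set_pmf \<nu>. pmf \<pi> (v, w))"
    using assms by (subst measure_measure_pmf_finite) (auto simp: sum.reindex inj_on_def)
  finally show "(\<Sum>w\<in>set_pmf \<nu>. pmf \<pi> (v, w)) = pmf \<mu> v" ..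
  have "pmf \<nu> w = measure (measure_pmf \<pi>) (snd -` {w})"
    using assms(1) by (auto simp: couplings_def pmf_map)
  also have "\<dots> = measure (measure_pmf \<pi>) ((\<lambda>v. (v, w)) ` set_pmf \<mu>)"
    using sub by (intro measure_prob_cong_0) (auto simp: set_pmf_iff)
  also have "\<dots> = (\<Sum>v\<in>set_pmf \<mu>. pmf \<pi> (v, w))"
    using assms by (subst measure_measure_pmf_finite) (auto simp: sum.reindex inj_on_def)
  finally show "(\<Sum>v\<in>set_pmf \<mu>. pmf \<pi> (v, w)) = pmf \<nu> w" ..
qed

lemma coupling_of_marginals:
  fixes f :: "'v \<times> 'v \<Rightarrow> real"
  assumes fin: "finite (set_pmf \<mu>)" "finite (set_pmf \<nu>)"
    and nonneg: "\<And>z. f z \<ge> 0"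
    and zero: "\<And>z. z \<notin> set_pmf \<mu> \<times> set_pmf \<nu> \<Longrightarrow> f z = 0"
    and m1: "\<And>v. (\<Sum>w\<in>set_pmf \<nu>. f (v, w)) = pmf \<mu> v"
    and m2: "\<And>w. (\<Sum>v\<in>set_pmf \<mu>. f (v, w)) = pmf \<nu> w"
  obtains \<pi> where "\<pi> \<in> couplings \<mu> \<nu>" "\<And>z. pmf \<pi> z = f z"
proof -
  let ?S = "set_pmf \<mu> \<times> set_pmf \<nu>"
  have "(\<Sum>z\<in>?S. f z) = (\<Sum>v\<in>set_pmf \<mu>. pmf \<mu> v)"
    by (simp add: sum.cartesian_product' m1)
  also have "\<dots> = 1"
    using fin by (simp add: sum_pmf_eq_1)
  finally have "(\<Sum>z\<in>?S. f z) = 1" .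
  moreover have "(\<integral>\<^sup>+ z. ennreal (f z) \<partial>count_space UNIV) = (\<Sum>z\<in>?S. ennreal (f z))"
    using fin zero by (intro nn_integral_count_space'[where A = ?S]) auto
  ultimately have int: "(\<integral>\<^sup>+ z. ennreal (f z) \<partial>count_space UNIV) = 1"
    by (simp add: nonneg)
  define \<pi> where "\<pi> = embed_pmf f"
  have pmf: "pmf \<pi> z = f z" for z
    unfolding \<pi>_def by (rule pmf_embed_pmf[OF nonneg int])
  have sub: "set_pmf \<pi> \<subseteq> ?S"
    using zero by (auto simp: set_pmf_iff pmf)
  have "pmf (map_pmf fst \<pi>) v = pmf \<mu> v" for v
  proof -
    have "pmf (map_pmf fst \<pi>) v = measure (measure_pmf \<pi>) (Pair v ` set_pmf \<nu>)"
      unfolding pmf_map using sub by (intro measure_prob_cong_0) (auto simp: set_pmf_iff)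
    also have "\<dots> = (\<Sum>w\<in>set_pmf \<nu>. f (v, w))"
      using fin by (subst measure_measure_pmf_finite) (auto simp: sum.reindex inj_on_def pmf)
    finally show ?thesis by (simp add: m1)
  qed
  moreover have "pmf (map_pmf snd \<pi>) w = pmf \<nu> w" for w
  proof -
    have "pmf (map_pmf snd \<pi>) w = measure (measure_pmf \<pi>) ((\<lambda>v. (v, w)) ` set_pmf \<mu>)"
      unfolding pmf_map using sub by (intro measure_prob_cong_0) (auto simp: set_pmf_iff)
    also have "\<dots> = (\<Sum>v\<in>set_pmf \<mu>. f (v, w))"
      using fin by (subst measure_measure_pmf_finite) (auto simp: sum.reindex inj_on_def pmf)
    finally show ?thesis by (simp add: m2)
  qed
  ultimately have "\<pi> \<in> couplings \<mu> \<nu>"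
    by (auto simp: couplings_def intro: pmf_eqI)
  with pmf show ?thesis by (rule that[rotated])
qed

lemma expectation_coupling:
  fixes c :: "'v \<times> 'v \<Rightarrow> real"
  assumes "\<pi> \<in> couplings \<mu> \<nu>" "finite (set_pmf \<mu>)" "finite (set_pmf \<nu>)"
  shows "integrable (measure_pmf \<pi>) c"
    and "measure_pmf.expectation \<pi> c = (\<Sum>z\<in>set_pmf \<mu> \<times> set_pmf \<nu>. c z * pmf \<pi> z)"
proof -
  note sub = set_pmf_coupling[OF assms(1)]
  have fin: "finite (set_pmf \<mu> \<times> set_pmf \<nu>)" using assms by simp
  show "integrable (measure_pmf \<pi>) c"
    using finite_subset[OF sub fin] by (rule integrable_measure_pmf_finite)
  show "measure_pmf.expectation \<pi> c = (\<Sum>z\<in>set_pmf \<mu> \<times> set_pmf \<nu>. c z * pmf \<pi> z)"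
    using sub by (intro integral_measure_pmf_real[OF fin]) auto
qed

lemma optimal_coupling_exists:
  fixes c :: "'v \<times> 'v \<Rightarrow> real"
  assumes fin: "finite (set_pmf \<mu>)" "finite (set_pmf \<nu>)"
  obtains \<pi> where "\<pi> \<in> couplings \<mu> \<nu>"
    "\<And>\<rho>. \<rho> \<in> couplings \<mu> \<nu> \<Longrightarrow>
       measure_pmf.expectation \<pi> c \<le> measure_pmf.expectation \<rho> c"
proof -
  let ?S = "set_pmf \<mu> \<times> set_pmf \<nu>"
  define B :: "'v \<times> 'v \<Rightarrow> real set" where "B z = (if z \<in> ?S then {0..1} else {0})" for z
  define M where "M = {f :: 'v \<times> 'v \<Rightarrow> real.
    (\<forall>v. (\<Sum>w\<in>set_pmf \<nu>. f (v, w)) = pmf \<mu> v) \<and>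
    (\<forall>w. (\<Sum>v\<in>set_pmf \<mu>. f (v, w)) = pmf \<nu> w)}"
  define K where "K = PiE UNIV B \<inter> M"
  have "compactin (product_topology (\<lambda>_. euclidean) UNIV) (PiE UNIV B)"
    by (subst compactin_PiE) (auto simp: B_def)
  then have "compact (PiE UNIV B)"
    by (simp add: euclidean_product_topology)
  moreover have "closed M"
    unfolding M_def
    by (intro closed_Collect_conj closed_Collect_all closed_Collect_eq continuous_on_sum
        continuous_on_const continuous_on_product_coordinates)
  ultimately have "compact K"
    unfolding K_def by (rule compact_Int_closed)
  have in_K: "pmf \<rho> \<in> K" if "\<rho> \<in> couplings \<mu> \<nu>" for \<rho>
    using coupling_marginals[OF that fin] set_pmf_coupling[OF that]
    by (auto simp: K_def M_def B_def pmf_le_1 set_pmf_iff)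
  have "pair_pmf \<mu> \<nu> \<in> couplings \<mu> \<nu>"
    by (simp add: couplings_def map_fst_pair_pmf map_snd_pair_pmf)
  then have "K \<noteq> {}"
    using in_K by blast
  define F where "F f = (\<Sum>z\<in>?S. c z * f z)" for f :: "'v \<times> 'v \<Rightarrow> real"
  have "continuous_on K F"
    unfolding F_def
    by (intro continuous_on_sum continuous_on_mult continuous_on_const
        continuous_on_subset[OF continuous_on_product_coordinates]) auto
  from continuous_attains_inf[OF \<open>compact K\<close> \<open>K \<noteq> {}\<close> this]
  obtain f where f: "f \<in> K" "\<And>g. g \<in> K \<Longrightarrow> F f \<le> F g" by blast
  have fB: "f z \<in> B z" for z
    using f(1) by (auto simp: K_def)
  have f_nonneg: "f z \<ge> 0" for z
    using fB[of z] by (auto simp: B_def split: if_splits)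
  have f_zero: "f z = 0" if "z \<notin> ?S" for z
    using fB[of z] that by (auto simp: B_def split: if_splits)
  obtain \<pi> where \<pi>: "\<pi> \<in> couplings \<mu> \<nu>" "\<And>z. pmf \<pi> z = f z"
    using f(1) by (rule_tac coupling_of_marginals[OF fin f_nonneg f_zero]) (auto simp: K_def M_def)
  show ?thesis
  proof (rule that[OF \<pi>(1)])
    fix \<rho> assume \<rho>: "\<rho> \<in> couplings \<mu> \<nu>"
    show "measure_pmf.expectation \<pi> c \<le> measure_pmf.expectation \<rho> c"
      using f(2)[OF in_K[OF \<rho>]]
      by (simp add: expectation_coupling(2)[OF \<pi>(1) fin] expectation_coupling(2)[OF \<rho> fin]
          \<pi>(2) F_def)
  qed
qed

lemma W1_attained:
  assumes fin: "finite (set_pmf \<mu>)" "finite (set_pmf \<nu>)"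
  obtains \<pi> where "\<pi> \<in> couplings \<mu> \<nu>"
    "W1 V E \<mu> \<nu> = (\<Sum>(v, w)\<in>set_pmf \<mu> \<times> set_pmf \<nu>. real (gdist V E v w) * pmf \<pi> (v, w))"
    "\<And>\<rho>. \<rho> \<in> couplings \<mu> \<nu> \<Longrightarrow>
       W1 V E \<mu> \<nu> \<le> (\<Sum>(v, w)\<in>set_pmf \<mu> \<times> set_pmf \<nu>. real (gdist V E v w) * pmf \<rho> (v, w))"
proof -
  let ?c = "\<lambda>(v, w). real (gdist V E v w)"
  obtain \<pi> where \<pi>: "\<pi> \<in> couplings \<mu> \<nu>"
    "\<And>\<rho>. \<rho> \<in> couplings \<mu> \<nu> \<Longrightarrow>
       measure_pmf.expectation \<pi> ?c \<le> measure_pmf.expectation \<rho> ?c"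
    using optimal_coupling_exists[OF fin] by blast
  have W: "W1 V E \<mu> \<nu> = measure_pmf.expectation \<pi> ?c"
    unfolding W1_def
  proof (rule cInf_eq_minimum)
    show "measure_pmf.expectation \<pi> ?c \<in> {measure_pmf.expectation \<pi> ?c |\<pi>.
        \<pi> \<in> couplings \<mu> \<nu> \<and> integrable (measure_pmf \<pi>) ?c}"
      using \<pi>(1) expectation_coupling(1)[OF \<pi>(1) fin] by blast
  qed (use \<pi>(2) in blast)
  have ex: "measure_pmf.expectation \<rho> ?c =
      (\<Sum>(v, w)\<in>set_pmf \<mu> \<times> set_pmf \<nu>. real (gdist V E v w) * pmf \<rho> (v, w))"
    if "\<rho> \<in> couplings \<mu> \<nu>" for \<rho>
    using expectation_coupling(2)[OF that fin, of ?c] by (simp add: case_prod_unfold)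
  show ?thesis
    by (rule that[OF \<pi>(1)]) (use W ex \<pi> in auto)
qed

end

theory Submission
  imports Defs "HOL-Real_Asymp.Real_Asymp"
begin

text \<open>
  On a tree, keep the common part of the two uniform measures in place and move the rest. A vertex of
  \<open>B_X - B_Y\<close> is closer to \<open>X\<close> than to \<open>Y\<close>, a vertex of \<open>B_Y - B_X\<close> is closer to \<open>Y\<close>, and between
  two such vertices the distance is \<open>f w - f v\<close> for a fixed 1-Lipschitz function \<open>f\<close>, namely the
  position of the projection to the geodesic from \<open>X\<close> to \<open>Y\<close>, minus (near \<open>X\<close>) or plus (near \<open>Y\<close>)
  the distance to the geodesic. Hence every bijection \<open>B_X \<rightarrow> B_Y\<close> that fixes the intersection is an
  optimal coupling with dual certificate \<open>f\<close>. Counting vertices by projection and height above the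
  geodesic gives the exact value of \<open>W1\<close> for \<open>n \<ge> d\<close>: it is \<open>q ^ n / card B_X\<close> times an
  affine function of \<open>n\<close>, and that quotient converges exponentially fast.
\<close>

section \<open>Distances in trees\<close>

locale tree_graph =
  fixes V :: "'v set" and E :: "'v \<Rightarrow> 'v \<Rightarrow> bool"
  assumes tree: "tree V E"
begin

abbreviation dst :: "'v \<Rightarrow> 'v \<Rightarrow> nat" where "dst \<equiv> gdist V E"

lemma adjD: "E u v \<Longrightarrow> u \<in> V" "E u v \<Longrightarrow> v \<in> V" "E u v \<Longrightarrow> u \<noteq> v" "E u v \<Longrightarrow> E v u"
  using tree unfolding tree_def simple_graph_def by blast+

lemma geodesic_exists:
  assumes "u \<in> V" "v \<in> V"
  obtains xs where "walk V E u xs v" "length xs = dst u v + 1"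
proof -
  obtain ys where "walk V E u ys v"
    using tree assms unfolding tree_def connected_graph_def by blast
  then have "\<exists>k xs. walk V E u xs v \<and> length xs = k + 1"
    by (intro exI[of _ "length ys - 1"] exI[of _ ys]) (auto simp: walk_def neq_Nil_conv)
  from LeastI_ex[OF this] show ?thesis
    using that unfolding gdist_def by blast
qed

lemma gdist_le_walk:
  assumes "walk V E u xs v" "length xs = k + 1"
  shows "dst u v \<le> k"
  unfolding gdist_def using assms by (intro Least_le) blast

lemma gdist_self: "u \<in> V \<Longrightarrow> dst u u = 0"
  using gdist_le_walk[of u "[u]" u 0] by (auto simp: walk_def)

lemma gdist_eq_0:
  assumes "u \<in> V" "v \<in> V" "dst u v = 0"
  shows "u = v"
proof -
  obtain xs where "walk V E u xs v" "length xs = 0 + 1"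
    using geodesic_exists[OF assms(1,2)] assms(3) by auto
  then show ?thesis by (auto simp: walk_def length_Suc_conv)
qed

lemma gdist_le_sym:
  assumes "u \<in> V" "v \<in> V"
  shows "dst v u \<le> dst u v"
proof -
  obtain xs where xs: "walk V E u xs v" "length xs = dst u v + 1"
    using geodesic_exists[OF assms] .
  have "successively E (rev xs)"
    unfolding successively_rev using xs(1)
    by (auto simp: walk_def intro: successively_mono dest: adjD)
  then have "walk V E v (rev xs) u"
    using xs(1) by (auto simp: walk_def hd_rev last_rev)
  then show ?thesis
    using gdist_le_walk xs(2) by simp
qed

lemma gdist_sym: "u \<in> V \<Longrightarrow> v \<in> V \<Longrightarrow> dst u v = dst v u"
  using gdist_le_sym[of u v] gdist_le_sym[of v u] by simp

lemma gdist_adj_le: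
  assumes "u \<in> V" "E v w"
  shows "dst u w \<le> dst u v + 1"
proof -
  obtain xs where xs: "walk V E u xs v" "length xs = dst u v + 1"
    using geodesic_exists[OF assms(1) adjD(1)[OF assms(2)]] .
  have "walk V E u (xs @ [w]) w"
    using xs(1) assms adjD[OF assms(2)] by (auto simp: walk_def successively_append_iff)
  then show ?thesis
    using gdist_le_walk[of u "xs @ [w]" w] xs(2) by simp
qed

lemma parent_exists:
  assumes "u \<in> V" "v \<in> V" "dst u v = Suc m"
  obtains p where "E p v" "dst u p = m"
proof -
  obtain xs where xs: "walk V E u xs v" "length xs = Suc m + 1"
    using geodesic_exists[OF assms(1,2)] assms(3) by auto
  define ys where "ys = butlast xs"
  have "xs = ys @ [v]" "length ys = m + 1"
    using xs by (auto simp: ys_def walk_def)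
  moreover from this have "ys \<noteq> []" by auto
  ultimately have "E (last ys) v" "walk V E u ys (last ys)"
    using xs(1) by (auto simp: walk_def successively_append_iff)
  moreover from gdist_le_walk[OF this(2) \<open>length ys = m + 1\<close>] have "dst u (last ys) \<le> m" .
  moreover have "Suc m \<le> dst u (last ys) + 1"
    using gdist_adj_le[OF assms(1) \<open>E (last ys) v\<close>] assms(3) by simp
  ultimately show ?thesis using that by force
qed

text \<open>Walk back from \<open>v\<close> to \<open>u\<close> through vertices at decreasing
  distance from \<open>u\<close> and add up the edge bounds. With \<open>f\<close> a distance
  function this yields the triangle inequality; later it reduces the Lipschitz property of the
  potential to a check on single edges.\<close>

lemma lipschitz_along_edges:
  fixes f :: "'v \<Rightarrow> real"
  assumes edge: "\<And>u v. E u v \<Longrightarrow> f v - f u \<le> 1"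
    and "u \<in> V" "v \<in> V"
  shows "f v - f u \<le> dst u v"
  using \<open>v \<in> V\<close>
proof (induction "dst u v" arbitrary: v)
  case 0
  then show ?case using gdist_eq_0[OF \<open>u \<in> V\<close>, of v] by simp
next
  case (Suc m)
  obtain p where p: "E p v" "dst u p = m"
    using parent_exists[OF \<open>u \<in> V\<close> Suc.prems] Suc.hyps(2) by metis
  then show ?case
    using Suc.hyps(1)[of p] Suc.hyps(2) edge[OF p(1)] adjD[OF p(1)] by simp
qed

lemma gdist_triangle:
  assumes "u \<in> V" "v \<in> V" "w \<in> V"
  shows "dst u w \<le> dst u v + dst v w"
proof -
  have "real (dst u w) - real (dst u v) \<le> dst v w"
    using assms gdist_adj_le[OF \<open>u \<in> V\<close>] by (intro lipschitz_along_edges) (fastforce simp: of_nat_diff)+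
  then show ?thesis by linarith
qed

text \<open>Follow parents from both vertices towards \<open>x\<close> until the two branches meet.
  The resulting simple path stays in the ball of radius \<open>m\<close>, so an edge between its
  ends, or a vertex outside the ball adjacent to both ends, closes it to a cycle. Every appeal to
  acyclicity goes through this lemma.\<close>

lemma path_within_ball:
  assumes "x \<in> V" "u \<in> V" "w \<in> V" "u \<noteq> w" "dst x u = m" "dst x w = m"
  shows "\<exists>xs. length xs \<ge> 3 \<and> distinct xs \<and> set xs \<subseteq> V \<and> successively E xs \<and>
    hd xs = u \<and> last xs = w \<and> (\<forall>y\<in>set xs. dst x y \<le> m)"
  using assms(2-)
proof (induction m arbitrary: u w)
  case 0
  then show ?case using gdist_eq_0[OF \<open>x \<in> V\<close>] by metis
next
  case (Suc m)
  obtain p where p: "E p u" "dst x p = m" using parent_exists \<open>x \<in> V\<close> Suc.prems by metis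
  obtain r where r: "E r w" "dst x r = m" using parent_exists \<open>x \<in> V\<close> Suc.prems by metis
  note adj = adjD[OF p(1)] adjD[OF r(1)]
  show ?case
  proof (cases "p = r")
    case True
    then show ?thesis
      using Suc.prems p r adj by (intro exI[of _ "[u, p, w]"]) auto
  next
    case False
    then obtain ys where ys: "length ys \<ge> 3" "distinct ys" "set ys \<subseteq> V" "successively E ys"
      "hd ys = p" "last ys = r" "\<forall>y\<in>set ys. dst x y \<le> m"
      using Suc.IH[of p r] p r adj by blast
    moreover from ys have "ys \<noteq> []" by auto
    moreover have "u \<notin> set ys" "w \<notin> set ys" using ys(7) Suc.prems by force+
    ultimately show ?thesis
      using Suc.prems p r adj
      by (intro exI[of _ "u # ys @ [w]"])
         (auto simp: successively_append_iff successively_Cons hd_append)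
  qed
qed

text \<open>An edge inside a sphere around \<open>x\<close> would close the path of
  \<open>path_within_ball\<close> to a cycle. Hence each edge changes the distance to any fixed
  vertex by exactly one.\<close>

lemma adj_gdist_neq:
  assumes "x \<in> V" "E u v"
  shows "dst x u \<noteq> dst x v"
proof
  assume "dst x u = dst x v"
  then obtain xs where "length xs \<ge> 3" "distinct xs" "set xs \<subseteq> V" "successively E xs"
    "hd xs = u" "last xs = v"
    using path_within_ball[OF assms(1) adjD(1-3)[OF assms(2)]] by metis
  then have "graph_cycle V E xs"
    using adjD[OF assms(2)] by (auto simp: graph_cycle_def)
  then show False using tree by (auto simp: tree_def)
qed

lemma adj_gdist_cases:
  assumes "x \<in> V" "E u v"
  shows "dst x v = dst x u + 1 \<or> dst x u = dst x v + 1"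
  using adj_gdist_neq[OF assms] gdist_adj_le[OF assms]
    gdist_adj_le[OF assms(1) adjD(4)[OF assms(2)]] by linarith

text \<open>A path joining two distinct parents stays at distance at most \<open>dst x u\<close>
  from \<open>x\<close>, so it avoids \<open>v\<close>, and \<open>v\<close> closes it to a
  cycle.\<close>

lemma parent_unique:
  assumes "x \<in> V" "E u v" "E w v" "dst x v = dst x u + 1" "dst x v = dst x w + 1"
  shows "u = w"
proof (rule ccontr)
  assume "u \<noteq> w"
  then obtain xs where xs: "length xs \<ge> 3" "distinct xs" "set xs \<subseteq> V" "successively E xs"
    "hd xs = u" "last xs = w" "\<forall>y\<in>set xs. dst x y \<le> dst x u"
    using path_within_ball[of x u w "dst x u"] assms adjD by fastforce
  moreover from this have "v \<notin> set xs" "xs \<noteq> []" using assms(4) by force+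
  ultimately have "graph_cycle V E (xs @ [v])"
    using assms adjD[OF assms(2)] by (auto simp: graph_cycle_def successively_append_iff hd_append)
  then show False using tree by (auto simp: tree_def)
qed

text \<open>The parent of \<open>u\<close> towards \<open>X\<close> differs from its parent \<open>v\<close> towards \<open>Y\<close>, so the situation
  propagates back along the geodesic from \<open>u\<close> to \<open>X\<close>.\<close>

lemma gdist_through_edge:
  assumes "X \<in> V" "Y \<in> V" "E u v" "dst X v = dst X u + 1" "dst Y u = dst Y v + 1"
  shows "dst X u + 1 + dst Y v = dst X Y"
  using assms(3-)
proof (induction "dst X u" arbitrary: u v)
  case 0
  then have "u = X" using gdist_eq_0 \<open>X \<in> V\<close> adjD by metis
  then show ?case using 0 gdist_sym \<open>X \<in> V\<close> \<open>Y \<in> V\<close> gdist_self by simp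
next
  case (Suc m)
  obtain p where p: "E p u" "dst X p = m"
    using parent_exists \<open>X \<in> V\<close> Suc.hyps(2) Suc.prems(1) adjD by metis
  have "p \<noteq> v" using p Suc by auto
  then have "dst Y p = dst Y u + 1"
    using adj_gdist_cases[OF \<open>Y \<in> V\<close> p(1)] parent_unique[OF \<open>Y \<in> V\<close> p(1) adjD(4)[OF Suc.prems(1)]]
      Suc.prems by fastforce
  then have "dst X p + 1 + dst Y u = dst X Y"
    using Suc.hyps(1)[of p u] Suc.hyps(2) p by simp
  then show ?case using p Suc by simp
qed

text \<open>Trees are bipartite: each edge changes both distances by one, so the parity of their sum
  is constant, and at \<open>X\<close> the sum is \<open>dst X Y\<close>. This makes the layer
  coordinates integral.\<close>

lemma gdist_parity:
  assumes "X \<in> V" "Y \<in> V" "v \<in> V"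
  shows "even (dst X v + dst Y v + dst X Y)"
  using assms(3)
proof (induction "dst X v" arbitrary: v)
  case 0
  then show ?case using gdist_eq_0[of X v] gdist_sym[of X Y] gdist_self[of X] assms by simp
next
  case (Suc m)
  obtain p where p: "E p v" "dst X p = m"
    using parent_exists \<open>X \<in> V\<close> Suc.hyps(2) Suc.prems by metis
  then have "even (dst X p + dst Y p + dst X Y)" using Suc.hyps adjD by metis
  then show ?case
    using adj_gdist_cases[OF \<open>Y \<in> V\<close> p(1)] p(2) Suc.hyps(2)[symmetric] by auto
qed

section \<open>Layers around a geodesic\<close>

text \<open>The vertices whose projection to the geodesic from \<open>X\<close> to \<open>Y\<close> has distance \<open>i\<close> to \<open>X\<close>, and
  whose distance to the geodesic is \<open>k\<close>.\<close>

definition layer :: "'v \<Rightarrow> 'v \<Rightarrow> nat \<Rightarrow> nat \<Rightarrow> 'v set" where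
  "layer X Y i k = {v \<in> V. dst X v = i + k \<and> dst Y v = (dst X Y - i) + k}"

lemma layerD:
  assumes "v \<in> layer X Y i k"
  shows "v \<in> V" "dst X v = i + k" "dst Y v = (dst X Y - i) + k"
  using assms by (auto simp: layer_def)

lemma layer_cover:
  assumes "X \<in> V" "Y \<in> V" "v \<in> V"
  obtains i k where "i \<le> dst X Y" "v \<in> layer X Y i k"
proof -
  let ?a = "dst X v" and ?b = "dst Y v" and ?d = "dst X Y"
  have t: "?d \<le> ?a + ?b" "?a \<le> ?d + ?b" "?b \<le> ?d + ?a"
    using gdist_triangle[of X v Y] gdist_triangle[of X Y v] gdist_triangle[of Y X v]
      gdist_sym[of v Y] gdist_sym[of X Y] assms by auto
  have "even (?a + ?b + ?d)" using gdist_parity assms by simp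
  then obtain s where s: "?a + ?b + ?d = 2 * s" by blast
  \<comment> \<open>With \<open>s\<close> the half perimeter of the triangle, the coordinates are
    Gromov products: \<open>s - ?b\<close> is half of \<open>?a + ?d - ?b\<close>, and
    \<open>s - ?d\<close> is half of \<open>?a + ?b - ?d\<close>. The inequalities \<open>t\<close>
    exclude truncated subtraction.\<close>
  have "v \<in> layer X Y (s - ?b) (s - ?d)" "s - ?b \<le> ?d"
    using t s \<open>v \<in> V\<close> by (auto simp: layer_def)
  then show ?thesis using that by blast
qed

lemma layer_disjoint:
  assumes "v \<in> layer X Y i k" "v \<in> layer X Y j l" "i \<le> dst X Y" "j \<le> dst X Y"
  shows "i = j \<and> k = l"
  using layerD(2,3)[OF assms(1)] layerD(2,3)[OF assms(2)] assms(3,4) by linarith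

lemma layer_towards:
  assumes "X \<in> V" "Y \<in> V" "Suc i \<le> dst X Y" "v \<in> layer X Y (Suc i) 0" "E u v" "dst X v = dst X u + 1"
  shows "u \<in> layer X Y i 0"
proof -
  have "dst X Y \<le> dst X u + dst Y u"
    using gdist_triangle[of X u Y] gdist_sym[of u Y] assms adjD[OF assms(5)] by auto
  then show ?thesis
    using adj_gdist_cases[OF \<open>Y \<in> V\<close> assms(5)] assms layerD[OF assms(4)] adjD[OF assms(5)]
    by (auto simp: layer_def)
qed

text \<open>By induction the predecessors of \<open>u\<close> and \<open>v\<close> towards
  \<open>X\<close> coincide; then \<open>u\<close> and \<open>v\<close> are both parents of that
  vertex towards \<open>Y\<close>.\<close>

lemma geodesic_vertex_unique:
  assumes "X \<in> V" "Y \<in> V" "i \<le> dst X Y" "u \<in> layer X Y i 0" "v \<in> layer X Y i 0"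
  shows "u = v"
  using assms(3-)
proof (induction i arbitrary: u v)
  case 0
  then show ?case using gdist_eq_0[OF \<open>X \<in> V\<close>] by (auto simp: layer_def)
next
  case (Suc i)
  note u = layerD[OF Suc.prems(2)] and v = layerD[OF Suc.prems(3)]
  obtain p where p: "E p u" "dst X p = i" using parent_exists[of X u i] \<open>X \<in> V\<close> u by auto
  obtain r where r: "E r v" "dst X r = i" using parent_exists[of X v i] \<open>X \<in> V\<close> v by auto
  have p': "p \<in> layer X Y i 0" using layer_towards[OF assms(1,2) Suc.prems(1,2) p(1)] u p by simp
  have r': "r \<in> layer X Y i 0" using layer_towards[OF assms(1,2) Suc.prems(1,3) r(1)] v r by simp
  have "p = r" using Suc.IH p' r' Suc.prems(1) by simp
  then show ?case
    using parent_unique[OF \<open>Y \<in> V\<close> adjD(4)[OF p(1)], of v] adjD(4)[OF r(1)] layerD[OF p'] u v Suc.prems(1)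
    by simp
qed

lemma geodesic_vertex:
  assumes "X \<in> V" "Y \<in> V" "i \<le> dst X Y"
  obtains p where "layer X Y i 0 = {p}"
proof -
  have "\<exists>p. p \<in> layer X Y i 0"
    using assms(3)
  proof (induction "dst X Y - i" arbitrary: i)
    case 0
    then have "Y \<in> layer X Y i 0" using assms gdist_self by (auto simp: layer_def)
    then show ?case by blast
  next
    case (Suc m)
    then obtain v where v: "v \<in> layer X Y (Suc i) 0"
      using Suc.hyps(1)[of "Suc i"] by fastforce
    obtain p where "E p v" "dst X p = i"
      using parent_exists[of X v i] \<open>X \<in> V\<close> layerD[OF v] by auto
    moreover have "Suc i \<le> dst X Y" using Suc.hyps(2) by simp
    ultimately show ?case
      using layer_towards[OF assms(1,2) _ v, of p] layerD[OF v] by auto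
  qed
  then show ?thesis using that geodesic_vertex_unique[OF assms] by blast
qed

text \<open>Off the geodesic, a step towards \<open>X\<close> is also a step towards
  \<open>Y\<close>. Otherwise \<open>gdist_through_edge\<close> would give
  \<open>dst X v + dst Y v = dst X Y\<close>, whereas the sum exceeds this by twice the positive
  height of \<open>v\<close>.\<close>

lemma layer_parent:
  assumes "X \<in> V" "Y \<in> V" "i \<le> dst X Y" "v \<in> layer X Y i (Suc k)" "E u v" "dst X v = dst X u + 1"
  shows "u \<in> layer X Y i k"
proof -
  have "dst Y u \<noteq> dst Y v + 1"
    using gdist_through_edge[OF assms(1,2,5,6)] assms(3,6) layerD[OF assms(4)] by auto
  then show ?thesis
    using adj_gdist_cases[OF \<open>Y \<in> V\<close> assms(5)] assms layerD[OF assms(4)] adjD[OF assms(5)]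
    by (auto simp: layer_def)
qed

lemma gdist_layer_geodesic:
  assumes "X \<in> V" "Y \<in> V" "i \<le> dst X Y" "v \<in> layer X Y i k"
  shows "\<exists>p\<in>layer X Y i 0. dst p v \<le> k"
  using assms(4)
proof (induction k arbitrary: v)
  case 0
  then show ?case using gdist_self layerD(1)[OF 0] by auto
next
  case (Suc k)
  obtain u where u: "E u v" "dst X u = i + k"
    using parent_exists[of X v "i + k"] \<open>X \<in> V\<close> layerD[OF Suc.prems] by auto
  have "u \<in> layer X Y i k"
    using layer_parent[OF assms(1-3) Suc.prems u(1)] u layerD[OF Suc.prems] by simp
  then obtain p where p: "p \<in> layer X Y i 0" "dst p u \<le> k" using Suc.IH by blast
  then show ?case using gdist_adj_le[OF layerD(1)[OF p(1)] u(1)] by force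
qed

lemma gdist_on_geodesic:
  assumes "X \<in> V" "Y \<in> V" "i + m \<le> dst X Y" "v \<in> layer X Y i 0" "w \<in> layer X Y (i + m) 0"
  shows "dst v w \<le> m"
  using assms(3,5)
proof (induction m arbitrary: w)
  case 0
  then show ?case
    using geodesic_vertex_unique[OF assms(1,2) _ assms(4), of w] gdist_self layerD(1)[OF assms(4)] by simp
next
  case (Suc m)
  have w: "w \<in> layer X Y (Suc (i + m)) 0" using Suc.prems by simp
  obtain u where u: "E u w" "dst X u = i + m"
    using parent_exists[of X w "i + m"] \<open>X \<in> V\<close> layerD[OF w] by auto
  have "u \<in> layer X Y (i + m) 0"
    using layer_towards[OF assms(1,2) _ w u(1)] u layerD[OF w] Suc.prems by simp
  then show ?case
    using Suc.IH[of u] Suc.prems gdist_adj_le[OF layerD(1)[OF assms(4)] u(1)] by simp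
qed

text \<open>Go down to the geodesic, along it, and up again. Only this upper bound is proved by
  hand; where equality is required, the potential supplies the lower bound.\<close>

lemma gdist_between_layers:
  assumes "X \<in> V" "Y \<in> V" "i \<le> j" "j \<le> dst X Y" "v \<in> layer X Y i k" "w \<in> layer X Y j l"
  shows "dst v w \<le> k + (j - i) + l"
proof -
  have "i \<le> dst X Y" using assms by simp
  from gdist_layer_geodesic[OF assms(1,2) this assms(5)]
  obtain p where p: "p \<in> layer X Y i 0" "dst p v \<le> k" by blast
  from gdist_layer_geodesic[OF assms(1,2,4,6)]
  obtain r where r: "r \<in> layer X Y j 0" "dst r w \<le> l" by blast
  have "dst p r \<le> j - i"
    using gdist_on_geodesic[OF assms(1,2) _ p(1), of "j - i" r] r assms by simp
  moreover note V = layerD(1)[OF p(1)] layerD(1)[OF r(1)] layerD(1)[OF assms(5)] layerD(1)[OF assms(6)]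
  moreover have "dst v w \<le> dst v p + (dst p r + dst r w)"
    using gdist_triangle[of v p w] gdist_triangle[of p r w] V by simp
  ultimately show ?thesis
    using p r gdist_sym[of v p] by simp
qed

section \<open>The Kantorovich potential\<close>

text \<open>On the layer \<open>(i, k)\<close> the first branch is \<open>i - k\<close> and the
  second is \<open>i + k\<close>. A tie forces \<open>2 * i = dst X Y\<close>, so everything hanging
  off the midpoint gets the constant value of the midpoint.\<close>

definition potential :: "'v \<Rightarrow> 'v \<Rightarrow> 'v \<Rightarrow> real" where
  "potential X Y v = (if dst X v < dst Y v then real (dst X Y) - real (dst Y v)
     else if dst Y v < dst X v then real (dst X v) else real (dst X Y) / 2)"

lemma potential_lipschitz:
  assumes "X \<in> V" "Y \<in> V" "u \<in> V" "v \<in> V"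
  shows "potential X Y v - potential X Y u \<le> dst u v"
proof (rule lipschitz_along_edges)
  fix u v assume uv: "E u v"
  \<comment> \<open>In the first two cases the comparison of \<open>dst X\<close> with
    \<open>dst Y\<close> is the same at both ends, so a single branch of the potential applies. The
    last two cases are the edges of the geodesic, where \<open>gdist_through_edge\<close> fixes the
    values.\<close>
  consider "dst X v = dst X u + 1" "dst Y v = dst Y u + 1" | "dst X u = dst X v + 1" "dst Y u = dst Y v + 1"
    | "dst X v = dst X u + 1" "dst Y u = dst Y v + 1" | "dst X u = dst X v + 1" "dst Y v = dst Y u + 1"
    using adj_gdist_cases[OF \<open>X \<in> V\<close> uv] adj_gdist_cases[OF \<open>Y \<in> V\<close> uv] by blast
  then show "potential X Y v - potential X Y u \<le> 1"
  proof cases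
    case 3
    then have "dst X u + 1 + dst Y v = dst X Y" using gdist_through_edge assms uv by simp
    then have "real (dst X Y) = real (dst X u) + 1 + real (dst Y v)" by linarith
    moreover have "real (dst X v) = real (dst X u) + 1" "real (dst Y u) = real (dst Y v) + 1"
      using 3 by simp_all
    ultimately show ?thesis by (auto simp: potential_def field_simps)
  next
    case 4
    then have "dst X v + 1 + dst Y u = dst X Y" using gdist_through_edge adjD(4)[OF uv] assms by simp
    then have "real (dst X Y) = real (dst X v) + 1 + real (dst Y u)" by linarith
    moreover have "real (dst X u) = real (dst X v) + 1" "real (dst Y v) = real (dst Y u) + 1"
      using 4 by simp_all
    ultimately show ?thesis by (auto simp: potential_def field_simps)
  qed (auto simp: potential_def)
qed (use assms in auto)

lemma potential_tight:
  assumes "X \<in> V" "Y \<in> V" "v \<in> V" "w \<in> V" "dst X v < dst Y v" "dst Y w < dst X w"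
  shows "dst v w = potential X Y w - potential X Y v"
proof -
  obtain i k where v: "i \<le> dst X Y" "v \<in> layer X Y i k" using layer_cover assms by metis
  obtain j l where w: "j \<le> dst X Y" "w \<in> layer X Y j l" using layer_cover assms by metis
  note D = layerD[OF v(2)] layerD[OF w(2)]
  \<comment> \<open>Being nearer to \<open>X\<close> means \<open>2 * i < dst X Y\<close>, and being
    nearer to \<open>Y\<close> means \<open>2 * j > dst X Y\<close>.\<close>
  have "i \<le> j" using D assms v w by linarith
  then have "dst v w \<le> k + (j - i) + l" using gdist_between_layers assms v w by simp
  also have "real \<dots> = potential X Y w - potential X Y v"
    using D v(1) w(1) \<open>i \<le> j\<close> assms(5,6) by (simp add: potential_def of_nat_diff)
  finally show ?thesis using potential_lipschitz[OF assms(1-4)] by simp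
qed

end

text \<open>Weak Kantorovich duality with an explicit certificate. Every coupling costs at least the
  expectation of \<open>f (snd z) - f (fst z)\<close>, which depends on the marginals alone, and the
  coupling carried by the graph of \<open>g\<close> attains this value.\<close>

lemma W1_uniform_eq:
  fixes f :: "'v \<Rightarrow> real"
  assumes fin: "finite A" "finite B" and ne: "A \<noteq> {}" and g: "bij_betw g A B"
    and lip: "\<And>v w. v \<in> A \<Longrightarrow> w \<in> B \<Longrightarrow> f w - f v \<le> gdist V E v w"
    and tight: "\<And>v. v \<in> A \<Longrightarrow> gdist V E v (g v) = f (g v) - f v"
  shows "W1 V E (pmf_of_set A) (pmf_of_set B) = (sum f B - sum f A) / card A"
proof -
  have ne': "B \<noteq> {}" and cardB: "card B = card A" and img: "g ` A = B" and inj: "inj_on g A"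
    using g ne bij_betw_same_card[OF g] by (auto simp: bij_betw_def)
  let ?c = "\<lambda>(v, w). real (gdist V E v w)"
  have set: "set_pmf (pmf_of_set A) = A" "set_pmf (pmf_of_set B) = B" using fin ne ne' by auto
  then have finp: "finite (set_pmf (pmf_of_set A))" "finite (set_pmf (pmf_of_set B))" using fin by auto
  show ?thesis unfolding W1_def
  proof (rule cInf_eq_minimum)
    define \<pi> where "\<pi> = map_pmf (\<lambda>v. (v, g v)) (pmf_of_set A)"
    have \<pi>: "\<pi> \<in> couplings (pmf_of_set A) (pmf_of_set B)"
      using fin ne inj img
      by (auto simp: couplings_def \<pi>_def map_pmf_comp map_pmf_of_set_inj)
    have "measure_pmf.expectation \<pi> ?c = (\<Sum>v\<in>A. real (gdist V E v (g v))) / card A"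
      using fin ne by (simp add: \<pi>_def integral_pmf_of_set)
    also have "(\<Sum>v\<in>A. real (gdist V E v (g v))) = sum (f \<circ> g) A - sum f A"
      by (simp add: tight sum_subtractf)
    also have "sum (f \<circ> g) A = sum f B"
      using sum.reindex[OF inj, of f] img by simp
    finally show "(sum f B - sum f A) / card A \<in> {measure_pmf.expectation \<pi> ?c |\<pi>.
        \<pi> \<in> couplings (pmf_of_set A) (pmf_of_set B) \<and> integrable (measure_pmf \<pi>) ?c}"
      using \<pi> expectation_coupling(1)[OF \<pi> finp] by force
  next
    fix x assume "x \<in> {measure_pmf.expectation \<pi> ?c |\<pi>.
        \<pi> \<in> couplings (pmf_of_set A) (pmf_of_set B) \<and> integrable (measure_pmf \<pi>) ?c}"
    then obtain \<pi> where \<pi>: "\<pi> \<in> couplings (pmf_of_set A) (pmf_of_set B)"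
      and x: "x = measure_pmf.expectation \<pi> ?c" by blast
    note int = expectation_coupling(1)[OF \<pi> finp]
    have m: "pmf_of_set A = map_pmf fst \<pi>" "pmf_of_set B = map_pmf snd \<pi>"
      using \<pi> by (auto simp: couplings_def)
    have "sum f A / card A = measure_pmf.expectation \<pi> (\<lambda>z. f (fst z))"
      using integral_pmf_of_set[OF ne fin(1), of f] unfolding m by simp
    moreover have "sum f B / card A = measure_pmf.expectation \<pi> (\<lambda>z. f (snd z))"
      using integral_pmf_of_set[OF ne' fin(2), of f] unfolding m cardB by simp
    ultimately have "(sum f B - sum f A) / card A
        = measure_pmf.expectation \<pi> (\<lambda>z. f (snd z) - f (fst z))"
      using int by (simp add: diff_divide_distrib)
    also have "\<dots> \<le> x" unfolding x
      using set_pmf_coupling[OF \<pi>] lip set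
      by (intro integral_mono_AE int) (auto simp: AE_measure_pmf_iff)
    finally show "(sum f B - sum f A) / card A \<le> x" .
  qed
qed

section \<open>Counting in regular trees\<close>

locale regular_tree = tree_graph V E for V :: "'v set" and E +
  fixes q :: nat
  assumes regular: "regular V E (q + 1)"
begin

lemma finite_neighbours: "u \<in> V \<Longrightarrow> finite {v. E u v}"
  and card_neighbours: "u \<in> V \<Longrightarrow> card {v. E u v} = q + 1"
proof -
  have "{v \<in> V. E u v} = {v. E u v}" for u using adjD by blast
  then show "u \<in> V \<Longrightarrow> finite {v. E u v}" "u \<in> V \<Longrightarrow> card {v. E u v} = q + 1"
    using regular by (auto simp: regular_def)
qed

definition parents :: "'v \<Rightarrow> 'v \<Rightarrow> 'v set" where
  "parents X u = {v. E u v \<and> dst X u = dst X v + 1}"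

lemma card_parents:
  assumes "X \<in> V" "u \<in> V"
  shows "card (parents X u) = of_bool (dst X u > 0)"
proof (cases "dst X u")
  case 0
  then show ?thesis by (auto simp: parents_def)
next
  case (Suc m)
  then obtain p where "E p u" "dst X p = m" using parent_exists assms by metis
  then have "parents X u = {p}"
    using Suc by (auto simp: parents_def intro: adjD(4) parent_unique[OF \<open>X \<in> V\<close> adjD(4)])
  then show ?thesis using Suc by simp
qed

lemma layer_children:
  assumes "X \<in> V" "Y \<in> V" "u \<in> layer X Y i k"
  shows "{v. E u v \<and> v \<in> layer X Y i (Suc k)} = {v. E u v} - (parents X u \<union> parents Y u)"
  using adj_gdist_cases[OF assms(1), of u] adj_gdist_cases[OF assms(2), of u] layerD[OF assms(3)] adjD
  by (fastforce simp: layer_def parents_def)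

text \<open>On the geodesic the parents towards \<open>X\<close> and \<open>Y\<close> are distinct,
  and one is missing at each endpoint; off the geodesic they coincide.\<close>

lemma card_layer_parents:
  assumes "X \<in> V" "Y \<in> V" "i \<le> dst X Y" "u \<in> layer X Y i k"
  shows "card (parents X u \<union> parents Y u) = (if k = 0 then of_bool (i > 0) + of_bool (i < dst X Y) else 1)"
proof -
  note u = layerD[OF assms(4)]
  have fin: "finite (parents X u)" "finite (parents Y u)"
    by (rule finite_subset[OF _ finite_neighbours[OF u(1)]]; auto simp: parents_def)+
  note c = card_parents[OF assms(1) u(1)] card_parents[OF assms(2) u(1)]
  show ?thesis
  proof (cases "k = 0")
    case True
    \<comment> \<open>A common parent would have distances to \<open>X\<close> and \<open>Y\<close>
      adding up to \<open>dst X Y - 2\<close>.\<close>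
    have "parents X u \<inter> parents Y u = {}"
    proof -
      have "dst X Y \<le> dst X v + dst Y v" if "E u v" for v
        using gdist_triangle[of X v Y] gdist_sym[of v Y] assms adjD[OF that] by auto
      then show ?thesis using u True assms(3) by (fastforce simp: parents_def)
    qed
    then show ?thesis using c u True fin by (simp add: card_Un_disjoint)
  next
    case False
    have "dst Y u \<noteq> 0" using u False by auto
    have "parents X u \<subseteq> parents Y u"
    proof
      fix v assume v: "v \<in> parents X u"
      then have "E v u" "dst X u = dst X v + 1" using adjD by (auto simp: parents_def)
      then have "dst Y v \<noteq> dst Y u + 1"
        using gdist_through_edge[OF assms(1,2)] u False assms(3) by fastforce
      then show "v \<in> parents Y u"
        using adj_gdist_cases[OF \<open>Y \<in> V\<close>, of u v] v by (auto simp: parents_def)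
    qed
    then show ?thesis using c \<open>dst Y u \<noteq> 0\<close> False by (simp add: Un_absorb1)
  qed
qed

lemma card_layer_Suc:
  assumes "X \<in> V" "Y \<in> V" "i \<le> dst X Y" "finite (layer X Y i k)"
  shows "finite (layer X Y i (Suc k)) \<and> card (layer X Y i (Suc k)) =
    card (layer X Y i k) * (if k = 0 then q + 1 - (of_bool (i > 0) + of_bool (i < dst X Y)) else q)"
proof -
  let ?C = "\<lambda>u. {v. E u v \<and> v \<in> layer X Y i (Suc k)}"
  let ?m = "if k = 0 then q + 1 - (of_bool (i > 0) + of_bool (i < dst X Y)) else q"
  have fin: "finite (?C u)" and card: "card (?C u) = ?m" if u: "u \<in> layer X Y i k" for u
  proof -
    note f = finite_neighbours[OF layerD(1)[OF u]]
    show "finite (?C u)" using f by (rule rev_finite_subset) auto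
    have "parents X u \<union> parents Y u \<subseteq> {v. E u v}" by (auto simp: parents_def)
    then show "card (?C u) = ?m"
      unfolding layer_children[OF assms(1,2) u]
      using f finite_subset card_layer_parents[OF assms(1-3) u] card_neighbours[OF layerD(1)[OF u]]
      by (subst card_Diff_subset) auto
  qed
  have eq: "layer X Y i (Suc k) = (\<Union>u\<in>layer X Y i k. ?C u)"
  proof safe
    fix v assume v: "v \<in> layer X Y i (Suc k)"
    obtain u where u: "E u v" "dst X u = i + k"
      using parent_exists[of X v "i + k"] \<open>X \<in> V\<close> layerD[OF v] by auto
    then have "u \<in> layer X Y i k" using layer_parent[OF assms(1-3) v] layerD[OF v] by simp
    then show "v \<in> (\<Union>u\<in>layer X Y i k. ?C u)" using u v by blast
  qed
  \<comment> \<open>A vertex has only one parent towards \<open>X\<close>, so different vertices of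
    a layer have no common child.\<close>
  have "?C u \<inter> ?C w = {}" if "u \<in> layer X Y i k" "w \<in> layer X Y i k" "u \<noteq> w" for u w
    using parent_unique[OF assms(1), of u _ w] that by (auto simp: layer_def)
  then have "card (\<Union>u\<in>layer X Y i k. ?C u) = (\<Sum>u\<in>layer X Y i k. card (?C u))"
    using assms(4) fin by (intro card_UN_disjoint) auto
  moreover have "finite (layer X Y i (Suc k))"
    by (subst eq) (use fin assms(4) in blast)
  ultimately show ?thesis
    using eq card by auto
qed

lemma card_layer:
  assumes "X \<in> V" "Y \<in> V" "i \<le> dst X Y"
  shows "finite (layer X Y i k)" "card (layer X Y i 0) = 1"
    "card (layer X Y i (Suc k)) = (q + 1 - (of_bool (i > 0) + of_bool (i < dst X Y))) * q ^ k"
proof -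
  have 0: "finite (layer X Y i 0)" "card (layer X Y i 0) = 1"
    by (rule geodesic_vertex[OF assms]; simp)+
  have fin: "finite (layer X Y i k)" for k
    using 0 card_layer_Suc[OF assms] by (induction k) auto
  then show "finite (layer X Y i k)" "card (layer X Y i 0) = 1" using 0 by auto
  show "card (layer X Y i (Suc k)) = (q + 1 - (of_bool (i > 0) + of_bool (i < dst X Y))) * q ^ k"
    using card_layer_Suc[OF assms fin] 0 by (induction k) auto
qed

section \<open>Balls, their differences and the exact transport cost\<close>

lemma ball_layers: "X \<in> V \<Longrightarrow> gball V E X n = (\<Union>k\<le>n. layer X X 0 k)"
  by (auto simp: layer_def gdist_self gball_def)

text \<open>The layers of the degenerate geodesic from \<open>X\<close> to \<open>X\<close> are the
  spheres around \<open>X\<close>, so the layer count applies with \<open>Y = X\<close>.\<close>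

lemma card_gball:
  assumes "X \<in> V"
  shows "finite (gball V E X n)" "X \<in> gball V E X n"
    "card (gball V E X n) = 1 + (\<Sum>k<n. (q + 1) * q ^ k)"
proof -
  note L = card_layer[OF assms assms, of 0]
  show "finite (gball V E X n)" using L by (simp add: ball_layers assms)
  show "X \<in> gball V E X n" using assms gdist_self by (simp add: gball_def)
  have "card (gball V E X n) = (\<Sum>k\<le>n. card (layer X X 0 k))"
    unfolding ball_layers[OF assms] using L
    by (intro card_UN_disjoint) (auto simp: layer_def)
  also have "\<dots> = 1 + (\<Sum>k<n. (q + 1) * q ^ k)"
    using L assms by (simp add: sum.atMost_shift gdist_self)
  finally show "card (gball V E X n) = 1 + (\<Sum>k<n. (q + 1) * q ^ k)" .
qed

text \<open>The vertex \<open>v\<close> of the layer \<open>(i, k)\<close> lies in the difference iff \<open>j = n - i - k\<close> satisfies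
  \<open>0 \<le> j < d - 2 i\<close>.\<close>

lemma sum_ball_diff:
  fixes h :: "nat \<Rightarrow> real"
  assumes "X \<in> V" "Y \<in> V" "dst X Y = d" "d \<le> n"
  shows "(\<Sum>v\<in>gball V E X n - gball V E Y n. h (dst Y v)) =
    (\<Sum>i<(d + 1) div 2. \<Sum>j<d - 2 * i. h (n + d - 2 * i - j) * real ((if i = 0 then q else q - 1) * q ^ (n - i - j - 1)))"
proof -
  let ?I = "SIGMA i:{..<(d + 1) div 2}. {..<d - 2 * i}"
  let ?L = "\<lambda>(i, j). layer X Y i (n - i - j)"
  \<comment> \<open>Since \<open>d \<le> n\<close>, all heights \<open>n - i - j\<close> are
    positive: no vertex of the difference lies on the geodesic.\<close>
  have *: "i \<le> d" "i + j < d" "i + j < n" if "(i, j) \<in> ?I" for i j using that assms(4) by auto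
  have "gball V E X n - gball V E Y n = (\<Union>z\<in>?I. ?L z)"
  proof (intro set_eqI iffI)
    fix v assume v: "v \<in> gball V E X n - gball V E Y n"
    then have "v \<in> V" by (simp add: gball_def)
    then obtain i k where ik: "i \<le> d" "v \<in> layer X Y i k" using layer_cover assms by metis
    then have "i + k \<le> n" "n < d - i + k" using v layerD[OF ik(2)] assms by (auto simp: gball_def)
    then have "(i, n - i - k) \<in> ?I" "n - i - (n - i - k) = k" using ik(1) by auto
    then show "v \<in> (\<Union>z\<in>?I. ?L z)" using ik(2) by force
  next
    fix v assume "v \<in> (\<Union>z\<in>?I. ?L z)"
    then obtain i j where ij: "(i, j) \<in> ?I" "v \<in> layer X Y i (n - i - j)" by auto
    then show "v \<in> gball V E X n - gball V E Y n"
      using layerD[OF ij(2)] *[OF ij(1)] assms by (auto simp: gball_def)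
  qed
  then have "(\<Sum>v\<in>gball V E X n - gball V E Y n. h (dst Y v)) = (\<Sum>z\<in>?I. \<Sum>v\<in>?L z. h (dst Y v))"
  proof (simp only:, intro sum.UNION_disjoint ballI impI)
    fix y z assume yz: "y \<in> ?I" "z \<in> ?I" "y \<noteq> z"
    obtain i j where y: "y = (i, j)" by fastforce
    obtain i' j' where z: "z = (i', j')" by fastforce
    show "?L y \<inter> ?L z = {}"
    proof (rule ccontr)
      assume "?L y \<inter> ?L z \<noteq> {}"
      then obtain v where "v \<in> layer X Y i (n - i - j)" "v \<in> layer X Y i' (n - i' - j')"
        using y z by auto
      from layer_disjoint[OF this] show False
        using *[of i j] *[of i' j'] yz y z assms(3) by auto
    qed
  qed (use card_layer assms * in auto)
  also have "\<dots> = (\<Sum>(i, j)\<in>?I. h (n + d - 2 * i - j) * real ((if i = 0 then q else q - 1) * q ^ (n - i - j - 1)))"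
  proof (intro sum.cong refl)
    fix z assume "z \<in> ?I"
    then obtain i j where z: "z = (i, j)" and "i < (d + 1) div 2" "j < d - 2 * i" by auto
    then have l: "i < d" "i + j < n" using assms(4) by auto
    then obtain k where k: "n - i - j = Suc k" by (metis Suc_diff_Suc diff_diff_left)
    have "dst Y v = n + d - 2 * i - j" if "v \<in> layer X Y i (n - i - j)" for v
      using layerD[OF that] l assms by simp
    then have "(\<Sum>v\<in>layer X Y i (n - i - j). h (dst Y v)) = h (n + d - 2 * i - j) * card (layer X Y i (n - i - j))"
      by simp
    \<comment> \<open>As \<open>i < d\<close>, the foot of the branch has one neighbour on the
      geodesic if \<open>i = 0\<close> and two otherwise, which leaves \<open>q\<close> or
      \<open>q - 1\<close> branches.\<close>
    also have "card (layer X Y i (n - i - j)) = (if i = 0 then q else q - 1) * q ^ (n - i - j - 1)"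
      using card_layer(3)[OF assms(1,2), of i k] l k assms(3) by simp
    finally show "(\<Sum>v\<in>?L z. h (dst Y v)) = (case z of (i, j) \<Rightarrow>
      h (n + d - 2 * i - j) * real ((if i = 0 then q else q - 1) * q ^ (n - i - j - 1)))"
      unfolding z prod.case .
  qed
  also have "\<dots> = (\<Sum>i<(d + 1) div 2. \<Sum>j<d - 2 * i. h (n + d - 2 * i - j) * real ((if i = 0 then q else q - 1) * q ^ (n - i - j - 1)))"
    by (subst sum.Sigma) auto
  finally show ?thesis .
qed

lemma W1_balls:
  assumes "X \<in> V" "Y \<in> V" "dst X Y = d" "d \<le> n"
  shows "W1 V E (ball_measure V E X n) (ball_measure V E Y n) =
    (\<Sum>i<(d + 1) div 2. \<Sum>j<d - 2 * i. (2 * real n + real d - 4 * real i - 2 * real j) *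
       real ((if i = 0 then q else q - 1) * q ^ (n - i - j - 1))) / card (gball V E X n)"
proof -
  define A where "A = gball V E X n"
  define B where "B = gball V E Y n"
  let ?f = "potential X Y"
  have d': "dst Y X = d" using gdist_sym assms by simp
  note gA = card_gball[OF assms(1), of n, folded A_def] and gB = card_gball[OF assms(2), of n, folded B_def]
  note sA = sum_ball_diff[OF assms, folded A_def B_def]
    and sB = sum_ball_diff[OF assms(2,1) d' assms(4), folded A_def B_def]
  have V: "A \<subseteq> V" "B \<subseteq> V" by (auto simp: A_def B_def gball_def)
  have lA: "dst X v < dst Y v" if "v \<in> A - B" for v using that by (auto simp: A_def B_def gball_def)
  have lB: "dst Y v < dst X v" if "v \<in> B - A" for v using that by (auto simp: A_def B_def gball_def)
  \<comment> \<open>The right-hand side of \<open>sum_ball_diff\<close> depends only on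
    \<open>d\<close>, \<open>n\<close>, \<open>q\<close> and \<open>h\<close>, so exchanging
    \<open>X\<close> and \<open>Y\<close> preserves it. The weight 1 compares cardinalities; the
    weight \<open>real\<close> is used below for the sums of distances.\<close>
  have "real (card (A - B)) = real (card (B - A))"
    using sA[of "\<lambda>_. 1"] sB[of "\<lambda>_. 1"] by simp
  then obtain g where g: "bij_betw g (A - B) (B - A)"
    using finite_same_card_bij[of "A - B" "B - A"] gA gB by auto
  define G where "G v = (if v \<in> B then v else g v)" for v
  have "bij_betw G (A - B) (B - A)" using g by (rule bij_betw_cong[THEN iffD1, rotated]) (simp add: G_def)
  moreover have "bij_betw G (A \<inter> B) (A \<inter> B)"
    by (rule bij_betw_cong[THEN iffD1, OF _ bij_betw_id]) (simp add: G_def)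
  ultimately have "bij_betw G ((A - B) \<union> (A \<inter> B)) ((B - A) \<union> (A \<inter> B))"
    by (rule bij_betw_combine) auto
  moreover have "(A - B) \<union> (A \<inter> B) = A" "(B - A) \<union> (A \<inter> B) = B" by auto
  ultimately have G: "bij_betw G A B" by simp
  have "W1 V E (ball_measure V E X n) (ball_measure V E Y n) = (sum ?f B - sum ?f A) / card A"
    unfolding ball_measure_def A_def[symmetric] B_def[symmetric]
  proof (rule W1_uniform_eq[OF _ _ _ G])
    fix v w assume "v \<in> A" "w \<in> B"
    then show "?f w - ?f v \<le> dst v w" using potential_lipschitz assms V by blast
  next
    fix v assume v: "v \<in> A"
    show "dst v (G v) = ?f (G v) - ?f v"
    proof (cases "v \<in> B")
      case True
      then show ?thesis using v V gdist_self by (auto simp: G_def)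
    next
      case False
      then have "g v \<in> B - A" "G v = g v" using v g by (auto simp: bij_betw_def G_def)
      then show ?thesis using potential_tight[of X Y v "g v"] lA[of v] lB[of "g v"] v V False assms by auto
    qed
  qed (use gA gB in auto)
  also have "sum ?f B - sum ?f A = sum ?f (B - A) - sum ?f (A - B)"
    using sum.Int_Diff[of A ?f B] sum.Int_Diff[of B ?f A] gA gB by (simp add: Int_commute)
  also have "sum ?f (B - A) = (\<Sum>v\<in>B - A. real (dst X v))"
    using lB by (intro sum.cong) (force simp: potential_def)+
  also have "sum ?f (A - B) = (\<Sum>v\<in>A - B. real d - real (dst Y v))"
    using lA assms(3) by (intro sum.cong) (force simp: potential_def)+
  also have "(\<Sum>v\<in>B - A. real (dst X v)) = (\<Sum>v\<in>A - B. real (dst Y v))"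
    using sA[of real] sB[of real] by simp
  also have "\<dots> - (\<Sum>v\<in>A - B. real d - real (dst Y v)) = (\<Sum>v\<in>A - B. 2 * real (dst Y v) - real d)"
    by (simp add: sum_subtractf[symmetric])
  also have "\<dots> = (\<Sum>i<(d + 1) div 2. \<Sum>j<d - 2 * i. (2 * real n + real d - 4 * real i - 2 * real j) *
       real ((if i = 0 then q else q - 1) * q ^ (n - i - j - 1)))"
    unfolding sA[of "\<lambda>m. 2 * real m - real d"]
  proof (intro sum.cong refl)
    fix i j assume "i \<in> {..<(d + 1) div 2}" "j \<in> {..<d - 2 * i}"
    then have "2 * i + j \<le> n + d" by auto
    then have "2 * real (n + d - 2 * i - j) - real d = 2 * real n + real d - 4 * real i - 2 * real j"
      by (simp add: of_nat_diff)
    then show "(2 * real (n + d - 2 * i - j) - real d) * real ((if i = 0 then q else q - 1) * q ^ (n - i - j - 1)) =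
      (2 * real n + real d - 4 * real i - 2 * real j) * real ((if i = 0 then q else q - 1) * q ^ (n - i - j - 1))"
      by simp
  qed
  finally show ?thesis unfolding A_def .
qed

end

section \<open>Closed forms and asymptotics\<close>

text \<open>Multiplying by \<open>(1 - x)\<^sup>2\<close> turns the closed form into a polynomial
  identity, provable by induction without division.\<close>

lemma sum_linear_geometric:
  fixes x c :: real
  shows "(1 - x)\<^sup>2 * (\<Sum>j<m. (c - 2 * real j) * x ^ j) =
    c * (1 - x) * (1 - x ^ m) - 2 * x + 2 * real m * x ^ m - 2 * (real m - 1) * x ^ (m + 1)"
  by (induction m) (simp_all add: algebra_simps power2_eq_square)

text \<open>For \<open>x = 1 / q\<close> the summand is the size of a layer divided by
  \<open>q ^ n\<close>, so this is half the normalised coefficient of \<open>n\<close>. The bound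
  \<open>I\<close> is free for the induction, which starts at 1 because the row \<open>i = 0\<close>
  lacks the factor \<open>1 - x\<close>; each later row adds
  \<open>x ^ I - x ^ (d - I)\<close>.\<close>

lemma sum_slope:
  fixes x :: real
  assumes "1 \<le> I" "2 * I \<le> d + 1"
  shows "(1 - x) * (\<Sum>i<I. \<Sum>j<d - 2 * i. (if i = 0 then 1 else 1 - x) * x ^ (i + j)) =
    1 + x - x ^ I - x ^ (d - I + 1)"
  using assms
proof (induction I rule: dec_induct)
  case base
  have "(1 - x) * (\<Sum>j<d. x ^ j) = 1 - x ^ d" by (simp add: one_diff_power_eq)
  then show ?case using base by simp
next
  case (step I)
  have g: "(1 - x) * (\<Sum>j<m. x ^ j) = 1 - x ^ m" for m by (simp add: one_diff_power_eq)
  have "(\<Sum>j<d - 2 * I. (if I = 0 then 1 else 1 - x) * x ^ (I + j)) = x ^ I * ((1 - x) * (\<Sum>j<d - 2 * I. x ^ j))"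
    using step by (simp add: sum_distrib_left power_add algebra_simps)
  also have "\<dots> = x ^ I - x ^ (d - I)"
    using step unfolding g by (simp add: algebra_simps flip: power_add)
  finally have s: "(\<Sum>j<d - 2 * I. (if I = 0 then 1 else 1 - x) * x ^ (I + j)) = x ^ I - x ^ (d - I)" .
  have e: "d - I = Suc (d - Suc I)" using step by simp
  have IH: "(1 - x) * (\<Sum>i<I. \<Sum>j<d - 2 * i. (if i = 0 then 1 else 1 - x) * x ^ (i + j)) =
    1 + x - x ^ I - x ^ (d - I + 1)" using step by simp
  show ?case
    unfolding sum.lessThan_Suc distrib_left IH s using e by (simp add: algebra_simps)
qed

text \<open>The same induction for the part of the normalised cost that is constant in
  \<open>n\<close>, with rows evaluated by \<open>sum_linear_geometric\<close>.\<close>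

lemma sum_intercept:
  fixes x :: real
  assumes "1 \<le> I" "2 * I \<le> d + 1"
  shows "(1 - x)\<^sup>2 * (\<Sum>i<I. \<Sum>j<d - 2 * i. (real d - 4 * real i - 2 * real j) * ((if i = 0 then 1 else 1 - x) * x ^ (i + j))) =
    real d * (1 - x\<^sup>2) - 6 * x - 2 * x\<^sup>2 + (6 * x + (4 * real I - real d) * (1 - x)) * x ^ I
    + (real d * (1 - x) + 2 * x) * x ^ (d - I + 1)"
  using assms
proof (induction I rule: dec_induct)
  case base
  then show ?case
    using sum_linear_geometric[of x "real d" d]
    by (simp add: algebra_simps power2_eq_square)
next
  case (step I)
  let ?m = "d - 2 * I"
  have "(1 - x)\<^sup>2 * (\<Sum>j<?m. (real d - 4 * real I - 2 * real j) * ((if I = 0 then 1 else 1 - x) * x ^ (I + j)))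
    = (1 - x) * x ^ I * ((1 - x)\<^sup>2 * (\<Sum>j<?m. ((real d - 4 * real I) - 2 * real j) * x ^ j))"
    using step by (simp add: sum_distrib_left power_add mult_ac)
  also have "\<dots> = (1 - x) * (((real d - 4 * real I) * (1 - x) - 2 * x) * x ^ I
      + (2 * real ?m - 2 * (real ?m - 1) * x - (real d - 4 * real I) * (1 - x)) * (x ^ I * x ^ ?m))"
    unfolding sum_linear_geometric by (simp add: algebra_simps)
  also have "real ?m = real d - 2 * real I" using step by (simp add: of_nat_diff)
  also have "x ^ I * x ^ ?m = x ^ (d - I)" using step by (simp flip: power_add)
  finally have s: "(1 - x)\<^sup>2 * (\<Sum>j<?m. (real d - 4 * real I - 2 * real j) * ((if I = 0 then 1 else 1 - x) * x ^ (I + j)))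
    = (1 - x) * (((real d - 4 * real I) * (1 - x) - 2 * x) * x ^ I + (real d * (1 - x) + 2 * x) * x ^ (d - I))"
    by (simp add: algebra_simps)
  have e: "d - I = Suc (d - Suc I)" using step by simp
  have IH: "(1 - x)\<^sup>2 * (\<Sum>i<I. \<Sum>j<d - 2 * i. (real d - 4 * real i - 2 * real j) * ((if i = 0 then 1 else 1 - x) * x ^ (i + j))) =
    real d * (1 - x\<^sup>2) - 6 * x - 2 * x\<^sup>2 + (6 * x + (4 * real I - real d) * (1 - x)) * x ^ I
    + (real d * (1 - x) + 2 * x) * x ^ (d - I + 1)" using step by simp
  show ?case
    unfolding sum.lessThan_Suc distrib_left IH s using e by (simp add: algebra_simps power2_eq_square)
qed

text \<open>The prefactor is the limit of \<open>q ^ n\<close> divided by the size of the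
  ball.\<close>

lemma A_ball_eq:
  assumes "q \<ge> 2" "d \<ge> 1"
  shows "A_ball d q = (real q - 1) / (real q + 1) * (2 * (\<Sum>i<(d + 1) div 2. \<Sum>j<d - 2 * i.
    (if i = 0 then 1 else 1 - 1 / real q) * (1 / real q) ^ (i + j)))"
proof -
  define x where "x = 1 / real q"
  let ?S = "\<Sum>i<(d + 1) div 2. \<Sum>j<d - 2 * i. (if i = 0 then 1 else 1 - x) * x ^ (i + j)"
  have q: "real q = 1 / x" "0 < x" "x < 1" using assms by (auto simp: x_def)
  have e: "d - (d + 1) div 2 = d div 2" by simp
  have S: "(1 - x) * ?S = 1 + x - x ^ ((d + 1) div 2) - x ^ (d div 2 + 1)"
    using sum_slope[of "(d + 1) div 2" d x] assms unfolding e by simp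
  have fl: "\<lfloor>real d / 2\<rfloor> = int (d div 2)" "\<lceil>real d / 2\<rceil> = int ((d + 1) div 2)" by linarith+
  have p: "real q powi (1 - int m) = x ^ m / x" "real q powi (- int m) = x ^ m" for m
    using q by (simp_all add: power_int_diff power_int_minus x_def power_one_over field_simps)
  have "A_ball d q = 2 * (real q + 1 - x ^ ((d + 1) div 2) / x - x ^ (d div 2)) / (real q + 1)"
    unfolding A_ball_def Let_def fl p ..
  also have "\<dots> = 2 * (1 + x - x ^ ((d + 1) div 2) - x ^ (d div 2 + 1)) / (x * (real q + 1))"
    using q by (simp add: field_simps)
  also have "\<dots> = (real q - 1) / (real q + 1) * (2 * ?S)"
    unfolding S[symmetric] using q by (simp add: field_simps)
  finally show ?thesis unfolding x_def .
qed

lemma B_ball_eq: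
  assumes "q \<ge> 2" "d \<ge> 1"
  shows "B_ball d q = (real q - 1) / (real q + 1) * (\<Sum>i<(d + 1) div 2. \<Sum>j<d - 2 * i.
    (real d - 4 * real i - 2 * real j) * ((if i = 0 then 1 else 1 - 1 / real q) * (1 / real q) ^ (i + j)))"
proof -
  define x where "x = 1 / real q"
  let ?S = "\<Sum>i<(d + 1) div 2. \<Sum>j<d - 2 * i. (real d - 4 * real i - 2 * real j) * ((if i = 0 then 1 else 1 - x) * x ^ (i + j))"
  define a where "a = (d + 1) div 2"
  define b where "b = d div 2"
  have q: "real q = 1 / x" "0 < x" "x < 1" using assms by (auto simp: x_def)
  have e: "d - a = b" by (simp add: a_def b_def)
  have "(1 - x)\<^sup>2 * ?S = real d * (1 - x\<^sup>2) - 6 * x - 2 * x\<^sup>2 + (6 * x + (4 * real a - real d) * (1 - x)) * x ^ a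
    + (real d * (1 - x) + 2 * x) * x ^ (b + 1)"
    using sum_intercept[of a d x] assms unfolding e by (simp add: a_def)
  also have "\<dots> = real d * (1 - x\<^sup>2) - 6 * x - 2 * x\<^sup>2 + 2 * (real a * (1 - x) + 2 * x) * x ^ a
    + 2 * (real b * (1 - x) + 1 + x) * x ^ (b + 1)"
  proof -
    \<comment> \<open>The two expressions agree only through the relation of \<open>d\<close> to its
      two halves, hence the split by parity.\<close>
    consider "a = b" "d = 2 * b" | "a = Suc b" "d = 2 * b + 1" unfolding a_def b_def by linarith
    then show ?thesis by cases (simp_all add: algebra_simps)
  qed
  finally have S: "(1 - x)\<^sup>2 * ?S = \<dots>" .
  have fl: "\<lfloor>real d / 2\<rfloor> = int b" "\<lceil>real d / 2\<rceil> = int a" unfolding a_def b_def by linarith+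
  have p: "real q powi (1 - int m) = x ^ m / x" "real q powi (- int m) = x ^ m" for m
    using q by (simp_all add: power_int_diff power_int_minus x_def power_one_over field_simps)
  have nz: "(real q)\<^sup>2 - 1 \<noteq> 0" using assms by (simp add: power2_eq_1_iff)
  have cancel: "k * (y + z / k) = k * y + z" if "k \<noteq> 0" for k y z :: real
    using that by (simp add: field_simps)
  \<comment> \<open>The nonzero factor clears the denominators on both sides and is cancelled at the
    end.\<close>
  have "((real q)\<^sup>2 - 1) * x\<^sup>2 * B_ball d q = (1 - x)\<^sup>2 * ?S"
  proof -
    have "((real q)\<^sup>2 - 1) * B_ball d q = ((real q)\<^sup>2 - 1) * real d + (- 6 * real q - 2
       + 2 * (real a * (real q - 1) + 2) * (x ^ a / x) + 2 * (real b * (real q - 1) + real q + 1) * x ^ b)"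
      unfolding B_ball_def Let_def fl p of_int_of_nat_eq by (rule cancel[OF nz])
    then have "((real q)\<^sup>2 - 1) * x\<^sup>2 * B_ball d q = x\<^sup>2 * (((real q)\<^sup>2 - 1) * real d + (- 6 * real q - 2
       + 2 * (real a * (real q - 1) + 2) * (x ^ a / x) + 2 * (real b * (real q - 1) + real q + 1) * x ^ b))"
      by (simp add: mult_ac)
    also have "\<dots> = (1 - x)\<^sup>2 * ?S"
      unfolding S q(1) using q(2) by (simp add: field_simps power2_eq_square)
    finally show ?thesis .
  qed
  also have "\<dots> = ((real q)\<^sup>2 - 1) * x\<^sup>2 * ((real q - 1) / (real q + 1) * ?S)"
  proof -
    have "((real q)\<^sup>2 - 1) * x\<^sup>2 * ((real q - 1) / (real q + 1)) = (1 - x)\<^sup>2"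
    proof -
      have "((real q)\<^sup>2 - 1) * x\<^sup>2 = (1 - x) * (1 + x)"
        "real q - 1 = (1 - x) / x" "real q + 1 = (1 + x) / x"
        unfolding q(1) using q(2) by (simp_all add: field_simps power2_eq_square)
      then show ?thesis using q(2) by (simp add: power2_eq_square)
    qed
    then show ?thesis by (simp only: mult.assoc[symmetric])
  qed
  finally have "B_ball d q = (real q - 1) / (real q + 1) * ?S"
    by (rule mult_left_cancel[THEN iffD1, rotated]) (use nz q in simp)
  then show ?thesis unfolding x_def .
qed

theorem theorem7p13:
  fixes V :: "'v set" and E :: "'v \<Rightarrow> 'v \<Rightarrow> bool"
    and q d :: nat and X Y :: 'v
  assumes "q \<ge> 2" and "d \<ge> 1"
    and "tree V E" and "regular V E (q + 1)"
    and "X \<in> V" and "Y \<in> V" and "gdist V E X Y = d"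
  shows "(\<lambda>n::nat. W1 V E (ball_measure V E X n) (ball_measure V E Y n)
            - (A_ball d q * real n + B_ball d q)) \<in> o(\<lambda>_. 1)"
proof -
  interpret regular_tree V E q by unfold_locales (use assms in auto)
  define x where "x = 1 / real q"
  \<comment> \<open>\<open>r\<close> is the limit of \<open>c n\<close>; for
    \<open>n \<ge> d\<close> the exact distance is \<open>c n * (2 * S * n + T)\<close>.\<close>
  define r where "r = (real q - 1) / (real q + 1)"
  define S where "S = (\<Sum>i<(d + 1) div 2. \<Sum>j<d - 2 * i. (if i = 0 then 1 else 1 - x) * x ^ (i + j))"
  define T where "T = (\<Sum>i<(d + 1) div 2. \<Sum>j<d - 2 * i.
    (real d - 4 * real i - 2 * real j) * ((if i = 0 then 1 else 1 - x) * x ^ (i + j)))"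
  define c where "c n = real (q ^ n) / real (card (gball V E X n))" for n
  have q: "real q \<ge> 2" using assms by simp
  have AB: "A_ball d q = r * (2 * S)" "B_ball d q = r * T"
    unfolding r_def S_def T_def x_def
    by (simp_all only: A_ball_eq[OF assms(1,2)] B_ball_eq[OF assms(1,2)])
  have card: "real (card (gball V E X n)) = ((real q + 1) * real q ^ n - 2) / (real q - 1)" for n
  proof -
    have "(real q - 1) * (\<Sum>k<n. real q ^ k) = real q ^ n - 1" by (simp add: power_diff_1_eq)
    then have geo: "(\<Sum>k<n. real q ^ k) = (real q ^ n - 1) / (real q - 1)"
      using q by (simp add: field_simps)
    have "real (card (gball V E X n)) = 1 + (real q + 1) * (\<Sum>k<n. real q ^ k)"
      unfolding card_gball(3)[OF \<open>X \<in> V\<close>] by (simp add: sum_distrib_left distrib_right add.commute)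
    then show ?thesis unfolding geo using q by (simp add: field_simps)
  qed
  have W: "W1 V E (ball_measure V E X n) (ball_measure V E Y n) = c n * (2 * S * n + T)" if "d \<le> n" for n
  proof -
    have "(\<Sum>i<(d + 1) div 2. \<Sum>j<d - 2 * i. (2 * real n + real d - 4 * real i - 2 * real j) *
        real ((if i = 0 then q else q - 1) * q ^ (n - i - j - 1)))
      = (\<Sum>i<(d + 1) div 2. \<Sum>j<d - 2 * i. real (q ^ n) * (2 * n * ((if i = 0 then 1 else 1 - x) * x ^ (i + j))
        + (real d - 4 * real i - 2 * real j) * ((if i = 0 then 1 else 1 - x) * x ^ (i + j))))"
    proof (intro sum.cong refl)
      fix i j assume "i \<in> {..<(d + 1) div 2}" "j \<in> {..<d - 2 * i}"
      then have "i + j + 1 \<le> n" using that by auto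
      then obtain k where k: "n = i + j + Suc k" by (metis add.assoc le_add_diff_inverse Suc_eq_plus1 add.commute)
      have "real q ^ (i + j) * x ^ (i + j) = 1" using q by (simp add: x_def flip: power_mult_distrib)
      then have "real (q ^ n) * x ^ (i + j) = real q * real q ^ k" unfolding k
        by (simp add: power_add algebra_simps)
      then have "real ((if i = 0 then q else q - 1) * q ^ (n - i - j - 1)) = real (q ^ n) * x ^ (i + j) * (if i = 0 then 1 else 1 - x)"
        using q k by (simp add: x_def of_nat_diff field_simps)
      then show "(2 * real n + real d - 4 * real i - 2 * real j) * real ((if i = 0 then q else q - 1) * q ^ (n - i - j - 1))
        = real (q ^ n) * (2 * n * ((if i = 0 then 1 else 1 - x) * x ^ (i + j))
        + (real d - 4 * real i - 2 * real j) * ((if i = 0 then 1 else 1 - x) * x ^ (i + j)))"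
        by (simp only:) (simp add: algebra_simps)
    qed
    also have "\<dots> = real (q ^ n) * (2 * S * n + T)"
      by (simp add: S_def T_def sum.distrib flip: sum_distrib_left)
    finally show ?thesis
      unfolding W1_balls[OF \<open>X \<in> V\<close> \<open>Y \<in> V\<close> assms(7) that] c_def by simp
  qed
  \<comment> \<open>The deviation of \<open>c n\<close> from its limit is of order
    \<open>1 / q ^ n\<close>, small enough to absorb the linear growth of
    \<open>2 * S * n + T\<close>.\<close>
  have c: "c n - r = 2 * r / ((real q + 1) * real q ^ n - 2)" for n
  proof -
    have "(real q + 1) * real q ^ n - 2 > 0"
      using q mult_mono[of 3 "real q + 1" 1 "real q ^ n"] by simp
    then show ?thesis using q unfolding c_def card r_def by (simp add: field_simps)
  qed
  have "(\<lambda>n. 2 * r / ((real q + 1) * real q ^ n - 2) * (2 * S * real n + T)) \<longlonglongrightarrow> 0"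
  proof -
    have "(\<lambda>n. real n / ((real q + 1) * real q ^ n - 2)) \<longlonglongrightarrow> 0"
      "(\<lambda>n. 1 / ((real q + 1) * real q ^ n - 2)) \<longlonglongrightarrow> 0"
      using q by real_asymp+
    then have "(\<lambda>n. 4 * r * S * (real n / ((real q + 1) * real q ^ n - 2))
        + 2 * r * T * (1 / ((real q + 1) * real q ^ n - 2))) \<longlonglongrightarrow> 4 * r * S * 0 + 2 * r * T * 0"
      by (intro tendsto_intros)
    then show ?thesis by (simp add: add_divide_distrib algebra_simps)
  qed
  then have "(\<lambda>n. W1 V E (ball_measure V E X n) (ball_measure V E Y n) - (A_ball d q * real n + B_ball d q)) \<longlonglongrightarrow> 0"
  proof (rule Lim_transform_eventually)
    show "\<forall>\<^sub>F n in sequentially. 2 * r / ((real q + 1) * real q ^ n - 2) * (2 * S * real n + T) =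
      W1 V E (ball_measure V E X n) (ball_measure V E Y n) - (A_ball d q * real n + B_ball d q)"
      using eventually_ge_at_top[of d]
    proof eventually_elim
      case (elim n)
      then show ?case unfolding W[OF elim] AB c[symmetric] by (simp add: algebra_simps)
    qed
  qed
  then show ?thesis by (intro smalloI_tendsto) auto
qed

end
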